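(* Let $(O,Q)$ be an HMM realization of order $k$ of the stationary process $\{y_t\}$ with deterministic observation $\phi$, let $\rho$ be the stationary distribution of the state, and let the tensor $M$, the matrices $A,B,C$ and the null space $V_N$ be as defined in the context (for a fixed integer $n\ge 1$). Suppose $\hat k_N=k-\dim V_N<k$. Let $T_N=(t_{N,ij})\in\mathbb{R}^{\hat k_N\times k}$ be a full-row-rank matrix and $\hat\phi_N:\{1,\ldots,\hat k_N\}\to\{1,\ldots,d\}$ a map such that (i) $t_{N,ij}=0$ if $\hat\phi_N(i)\neq\phi(j)$; (ii) $V_N=\ker T_N$; (iii) $e^{\mathrm T}=\hat e_N^{\mathrm T}T_N$, where $\hat e_N\in\mathbb{R}^{\hat k_N}$ is the all-ones vector. Define $\hat Q_N\in\mathbb{R}^{\hat k_N\times\hat k_N}$, $\hat O_N\in\mathbb{R}^{d\times\hat k_N}$ and $\hat\rho_N\in\mathbb{R}^{\hat k_N}$ by $\hat Q_NT_N=T_NQ$, $\hat O_NT_N=O$ and $\hat\rho_N=T_N\rho$. Let $\hat I_{N,u}\in\mathbb{R}^{\hat k_N\times\hat k_N}$ be the diagonal matrix whose $(i,i)$th element is $1$ if $\hat\phi_N(i)=u$ and $0$ otherwise. Define $\hat A_N,\hat B_N\in\mathbb{R}^{d^n\times\hat k_N}$ and $\hat C_N\in\mathbb{R}^{d\times\hat k_N}$ by giving their $L(u_1^n)$th rows, for $u_1^n=(u_1,\ldots,u_n)\in\{1,\ldots,d\}^n$, $$\hat A_{N,L(u_1^n)}=\hat e_N^{\mathrm T}\hat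 I_{N,u_n}\hat Q_N\cdots\hat I_{N,u_1}\hat Q_N,\qquad \hat B_{N,L(u_1^n)}=\hat\rho_N^{\mathrm T}\hat I_{N,u_n}\hat Q_N^{\mathrm T}\cdots\hat I_{N,u_1}\hat Q_N^{\mathrm T},\qquad \hat C_N=\hat O_N .$$ Then $$M=A\otimes B\otimes C=\hat A_N\otimes\hat B_N\otimes\hat C_N .$$
   Context: Realization: $\{y_t\}_{t\in\mathbb{Z}}$ is a stationary process with values in $\{1,\ldots,d\}$. $\{x_t\}_{t\in\mathbb{Z}}$ is a stationary Markov chain on $\{1,\ldots,k\}$ with transition matrix $Q=(q_{ij})\in\mathbb{R}^{k\times k}$, $q_{ij}=\mathbb{P}(x_{t+1}=i\mid x_t=j)$ (so $Q$ is nonnegative and each column sums to one). $\phi:\{1,\ldots,k\}\to\{1,\ldots,d\}$ is a map, and $O=(o_{ij})\in\mathbb{R}^{d\times k}$ has $o_{ij}=1$ if $\phi(j)=i$ and $o_{ij}=0$ otherwise. "$(O,Q)$ is an HMM realization of order $k$ with deterministic observation $\phi$" means that $\{y_t\}$ and $\{\phi(x_t)\}$ have the same law. $e\in\mathbb{R}^k$ is the all-ones vector, so $e^{\mathrm T}Q=e^{\mathrm T}$; $\rho\in\mathbb{R}^k$ is the stationary distribution of $\{x_t\}$, $\rho_i=\mathbb{P}(x_t=i)$, so $Q\rho=\rho$. For $u=1,\ldots,d$, $I_u\in\mathbb{R}^{k\times k}$ is the diagonal matrix whose $(i,i)$th element is $1$ if $\phi(i)=u$ and $0$ otherwise. Null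 space: $V_N=\bigcap\{v\in\mathbb{R}^k: e^{\mathrm T}I_{u_n}Q\cdots I_{u_1}QI_{u_0}v=0\}$, the intersection being over all $(u_0,\ldots,u_n)\in\{1,\ldots,d\}^{n+1}$ and all $n=0,1,2,\ldots$. (It is $Q$-invariant, and the matrices $\hat Q_N$, $\hat O_N$ in the claim are well defined.) Tensor: for $u_1^n=(u_1,\ldots,u_n)\in\{1,\ldots,d\}^n$ put $L(u_1^n)=(u_1-1)d^{n-1}+(u_2-1)d^{n-2}+\cdots+(u_{n-1}-1)d+u_n\in\{1,\ldots,d^n\}$. $M\in\mathbb{R}^{d^n\times d^n\times d}$ is the third-order tensor with entries $M_{L(u_1,\ldots,u_n),\,L(u_{-1},\ldots,u_{-n}),\,u_0}=\mathbb{P}\{y_t=u_t \text{ for all } t=-n,\ldots,n\}$. The matrices $A,B\in\mathbb{R}^{d^n\times k}$ and $C\in\mathbb{R}^{d\times k}$ are given by rows $A_{L(u_1^n)}=e^{\mathrm T}I_{u_n}Q\cdots I_{u_1}Q$, $B_{L(u_1^n)}=\rho^{\mathrm T}I_{u_n}Q^{\mathrm T}\cdots I_{u_1}Q^{\mathrm T}$, and $C=O$. For matrices $X,Y,Z$ with the same number $r$ of columns $x_i,y_i,z_i$, $X\otimes Y\otimes Z$ denotes the third-order tensor $\sum_{i=1}^r x_i\otimes y_i\otimes z_i$ (a sum of $r$ rank-one tensors). *)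

theory Defs
  imports "HOL-Probability.Probability"
begin

(* A d x k matrix, with outputs numbered 1..d and states indexed by a finite type 'k
   (k = CARD('k)), is represented by its family of rows, of type nat => real^'k; only the rows
   1..d are meaningful. The same convention is used for matrices with d^n rows. *)

definition process :: "'a measure \<Rightarrow> (int \<Rightarrow> 'a \<Rightarrow> 'v) \<Rightarrow> bool" where
  "process P X \<longleftrightarrow> prob_space P \<and> (\<forall>t. X t \<in> measurable P (count_space UNIV))"

definition process_law :: "'a measure \<Rightarrow> (int \<Rightarrow> 'a \<Rightarrow> 'v) \<Rightarrow> (int \<Rightarrow> 'v) measure" where
  "process_law P X = distr P (Pi\<^sub>M UNIV (\<lambda>_. count_space UNIV)) (\<lambda>\<omega> t. X t \<omega>)"

definition stationary :: "'a measure \<Rightarrow> (int \<Rightarrow> 'a \<Rightarrow> 'v) \<Rightarrow> bool" where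
  "stationary P X \<longleftrightarrow> (\<forall>s. process_law P (\<lambda>t. X (t + s)) = process_law P X)"

definition markov_property :: "'a measure \<Rightarrow> (int \<Rightarrow> 'a \<Rightarrow> 'v) \<Rightarrow> bool" where
  "markov_property P X \<longleftrightarrow>
     (\<forall>(t::int) (m::nat) (s :: int \<Rightarrow> 'v) i.
        0 < \<P>(\<omega> in P. \<forall>r\<in>{t - int m..t}. X r \<omega> = s r) \<longrightarrow>
        \<P>(\<omega> in P. X (t + 1) \<omega> = i \<bar> \<forall>r\<in>{t - int m..t}. X r \<omega> = s r) =
        \<P>(\<omega> in P. X (t + 1) \<omega> = i \<bar> X t \<omega> = s t))"

(* Column convention: Q $ i $ j is the probability of moving from j to i. Columns of states that
   are never visited are not determined by the process, only required to be stochastic. *)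
definition transition_matrix :: "'a measure \<Rightarrow> (int \<Rightarrow> 'a \<Rightarrow> 'k::finite) \<Rightarrow> real^'k^'k \<Rightarrow> bool" where
  "transition_matrix P X Q \<longleftrightarrow>
     (\<forall>i j. 0 \<le> Q $ i $ j) \<and> (\<forall>j. (\<Sum>i\<in>UNIV. Q $ i $ j) = 1) \<and>
     (\<forall>t i j. 0 < \<P>(\<omega> in P. X t \<omega> = j) \<longrightarrow>
        \<P>(\<omega> in P. X (t + 1) \<omega> = i \<bar> X t \<omega> = j) = Q $ i $ j)"

definition stationary_markov_chain ::
    "'a measure \<Rightarrow> (int \<Rightarrow> 'a \<Rightarrow> 'k::finite) \<Rightarrow> real^'k^'k \<Rightarrow> bool" where
  "stationary_markov_chain P X Q \<longleftrightarrow>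
     process P X \<and> stationary P X \<and> markov_property P X \<and> transition_matrix P X Q"

definition stationary_distribution ::
    "'a measure \<Rightarrow> (int \<Rightarrow> 'a \<Rightarrow> 'k::finite) \<Rightarrow> real^'k \<Rightarrow> bool" where
  "stationary_distribution P X \<rho> \<longleftrightarrow> (\<forall>t i. \<rho> $ i = \<P>(\<omega> in P. X t \<omega> = i))"

definition observation_matrix :: "('k::finite \<Rightarrow> nat) \<Rightarrow> nat \<Rightarrow> real^'k" where
  "observation_matrix \<phi> i = (\<chi> j. if \<phi> j = i then 1 else 0)"

(* The observed process and the chain may live on different probability spaces. *)
definition hmm_realization ::
    "nat \<Rightarrow> 'a measure \<Rightarrow> (int \<Rightarrow> 'a \<Rightarrow> nat) \<Rightarrow> 'b measure \<Rightarrow> (int \<Rightarrow> 'b \<Rightarrow> 'k::finite) \<Rightarrow>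
     ('k \<Rightarrow> nat) \<Rightarrow> (nat \<Rightarrow> real^'k) \<Rightarrow> real^'k^'k \<Rightarrow> bool" where
  "hmm_realization d P y P' x \<phi> Obs Q \<longleftrightarrow>
     process P y \<and> stationary P y \<and> (\<forall>t. \<forall>\<omega>\<in>space P. y t \<omega> \<in> {1..d}) \<and>
     stationary_markov_chain P' x Q \<and>
     (\<forall>j. \<phi> j \<in> {1..d}) \<and>
     (\<forall>i\<in>{1..d}. Obs i = observation_matrix \<phi> i) \<and>
     process_law P y = process_law P' (\<lambda>t \<omega>. \<phi> (x t \<omega>))"

abbreviation ones :: "real^'k" where
  "ones \<equiv> (\<chi> i. 1)"

definition output_indicator :: "('k::finite \<Rightarrow> nat) \<Rightarrow> nat \<Rightarrow> real^'k^'k" where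
  "output_indicator \<phi> u = (\<chi> i j. if i = j \<and> \<phi> i = u then 1 else 0)"

(* For the word [u_1, ..., u_n] this is the product I_(u_n) Q ... I_(u_1) Q. *)
definition word_product :: "('k::finite \<Rightarrow> nat) \<Rightarrow> real^'k^'k \<Rightarrow> nat list \<Rightarrow> real^'k^'k" where
  "word_product \<phi> Q us = foldl (\<lambda>X u. output_indicator \<phi> u ** Q ** X) (mat 1) us"

definition words :: "nat \<Rightarrow> nat \<Rightarrow> nat list set" where
  "words d n = {us. set us \<subseteq> {1..d} \<and> length us = n}"

definition null_space :: "nat \<Rightarrow> ('k::finite \<Rightarrow> nat) \<Rightarrow> real^'k^'k \<Rightarrow> (real^'k) set" where
  "null_space d \<phi> Q =
     (\<Inter>n. \<Inter>u0\<in>{1..d}. \<Inter>us\<in>words d n.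
        {v. (ones v* (word_product \<phi> Q us ** output_indicator \<phi> u0)) \<bullet> v = 0})"

(* Lists are 0-indexed: us ! i is the (i+1)-st letter. *)
definition word_index :: "nat \<Rightarrow> nat list \<Rightarrow> nat" where
  "word_index d us =
     (\<Sum>i<length us - 1. (us ! i - 1) * d ^ (length us - 1 - i)) + last us"

definition index_word :: "nat \<Rightarrow> nat \<Rightarrow> nat \<Rightarrow> nat list" where
  "index_word d n = inv_into (words d n) (word_index d)"

lemma word_index_bij_betw:
  assumes "n \<ge> 1"
  shows "bij_betw (word_index d) (words d n) {1..d ^ n}"
proof -
  have append_letter: "word_index d (us @ [u]) = (word_index d us - 1) * d + u"
    if "us \<noteq> []" "set us \<subseteq> {1..d}" for us u
  proof -
    define m where "m = length us - 1"
    have len: "length us = Suc m" and last: "last us = us ! m"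
      using that by (auto simp: m_def last_conv_nth)
    have "us ! m \<ge> 1"
      using that(2) len nth_mem[of m us] by (auto simp del: nth_mem)
    moreover have "(\<Sum>i<m. ((us @ [u]) ! i - 1) * d ^ (Suc m - i)) =
        (\<Sum>i<m. (us ! i - 1) * d ^ (m - i)) * d"
      unfolding sum_distrib_right
      by (intro sum.cong) (auto simp: nth_append len Suc_diff_le)
    ultimately show ?thesis
      by (simp add: word_index_def len last nth_append algebra_simps diff_mult_distrib)
  qed
  have range: "word_index d us \<in> {1..d ^ length us}" if "us \<noteq> []" "set us \<subseteq> {1..d}" for us
    using that
  proof (induction us rule: rev_nonempty_induct)
    case (single x)
    then show ?case by (simp add: word_index_def)
  next
    case (snoc x xs)
    then have IH: "word_index d xs \<in> {1..d ^ length xs}" and x: "x \<in> {1..d}" by auto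
    have "(word_index d xs - 1) * d + x \<le> (word_index d xs - 1) * d + 1 * d"
      using x by simp
    also have "\<dots> = word_index d xs * d"
      using IH by (metis add_mult_distrib atLeastAtMost_iff le_add_diff_inverse2)
    also have "\<dots> \<le> d ^ length xs * d" using IH by (simp add: mult_right_mono)
    finally have le: "(word_index d xs - 1) * d + x \<le> d ^ length xs * d" .
    moreover have "word_index d (xs @ [x]) = (word_index d xs - 1) * d + x"
      using snoc.hyps snoc.prems by (intro append_letter) auto
    ultimately show ?case
      using x by (simp add: mult.commute)
  qed
  have inj: "us = vs"
    if "us \<noteq> []" "set us \<subseteq> {1..d}" "set vs \<subseteq> {1..d}" "length us = length vs"
       "word_index d us = word_index d vs" for us vs
    using that
  proof (induction us arbitrary: vs rule: rev_nonempty_induct)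
    case (single x)
    then obtain y where "vs = [y]" by (metis length_0_conv length_Suc_conv)
    with single show ?case by (simp add: word_index_def)
  next
    case (snoc x xs)
    obtain ys y where vs: "vs = ys @ [y]" "ys \<noteq> []" "length ys = length xs"
      using snoc.prems(3) snoc.hyps
      by (cases vs rule: rev_cases) (auto, metis length_0_conv)
    have xs: "set xs \<subseteq> {1..d}" "set ys \<subseteq> {1..d}" and xy: "x \<in> {1..d}" "y \<in> {1..d}"
      using snoc.prems vs by auto
    have eq: "(word_index d xs - 1) * d + x = (word_index d ys - 1) * d + y"
      using snoc.prems(4) vs snoc.hyps xs
      by (simp add: append_letter)
    then have eq': "(x - 1) + d * (word_index d xs - 1) = (y - 1) + d * (word_index d ys - 1)"
      using xy by (simp add: mult.commute)
    have "x - 1 < d" "y - 1 < d" using xy by auto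
    then have "x - 1 = y - 1" "word_index d xs - 1 = word_index d ys - 1"
      using arg_cong[OF eq', of "\<lambda>z. z mod d"] arg_cong[OF eq', of "\<lambda>z. z div d"] by auto
    moreover have "word_index d xs \<ge> 1" "word_index d ys \<ge> 1"
      using range[of xs] range[of ys] xs vs snoc.hyps by auto
    ultimately have "x = y" "word_index d xs = word_index d ys" using xy by auto
    then show ?case using snoc.IH[OF xs] vs by auto
  qed
  have "inj_on (word_index d) (words d n)"
  proof (rule inj_onI)
    fix us vs assume "us \<in> words d n" "vs \<in> words d n" "word_index d us = word_index d vs"
    then show "us = vs" using assms by (intro inj) (auto simp: words_def)
  qed
  moreover have "word_index d ` words d n \<subseteq> {1..d ^ n}"
  proof
    fix r assume "r \<in> word_index d ` words d n"
    then obtain us where us: "r = word_index d us" "set us \<subseteq> {1..d}" "length us = n"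
      by (auto simp: words_def)
    then have "us \<noteq> []" using assms by auto
    then show "r \<in> {1..d ^ n}" using range[of us] us by simp
  qed
  moreover have "card (words d n) = d ^ n"
    using card_lists_length_eq[of "{1..d}" n] by (simp add: words_def)
  ultimately have "word_index d ` words d n = {1..d ^ n}"
    by (intro card_subset_eq) (auto simp: card_image)
  with \<open>inj_on (word_index d) (words d n)\<close> show ?thesis
    by (simp add: bij_betw_def)
qed

lemma index_word_word_index:
  "n \<ge> 1 \<Longrightarrow> us \<in> words d n \<Longrightarrow> index_word d n (word_index d us) = us"
  unfolding index_word_def
  by (intro inv_into_f_f) (use word_index_bij_betw in \<open>auto simp: bij_betw_def\<close>)

(* Row number r = L(u_1, ..., u_n) is w^T I_(u_n) Q ... I_(u_1) Q. *)
definition word_rows ::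
    "('k::finite \<Rightarrow> nat) \<Rightarrow> real^'k^'k \<Rightarrow> real^'k \<Rightarrow> nat \<Rightarrow> nat \<Rightarrow> nat \<Rightarrow> real^'k" where
  "word_rows \<phi> Q w d n r = w v* word_product \<phi> Q (index_word d n r)"

definition A_matrix :: "('k::finite \<Rightarrow> nat) \<Rightarrow> real^'k^'k \<Rightarrow> nat \<Rightarrow> nat \<Rightarrow> nat \<Rightarrow> real^'k" where
  "A_matrix \<phi> Q d n = word_rows \<phi> Q ones d n"

definition B_matrix ::
    "('k::finite \<Rightarrow> nat) \<Rightarrow> real^'k^'k \<Rightarrow> real^'k \<Rightarrow> nat \<Rightarrow> nat \<Rightarrow> nat \<Rightarrow> real^'k" where
  "B_matrix \<phi> Q \<rho> d n = word_rows \<phi> (transpose Q) \<rho> d n"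

(* Tensors of a given shape are extensional functions on the index box, so that equality of
   tensors is equality of all entries. *)
definition tensor3 ::
    "nat \<times> nat \<times> nat \<Rightarrow> (nat \<Rightarrow> nat \<Rightarrow> nat \<Rightarrow> real) \<Rightarrow> (nat \<times> nat \<times> nat \<Rightarrow> real)" where
  "tensor3 = (\<lambda>(a, b, c) f. restrict (\<lambda>(i, j, l). f i j l) ({1..a} \<times> {1..b} \<times> {1..c}))"

(* sum over the columns i of x_i \<otimes> y_i \<otimes> z_i *)
definition triple_product ::
    "nat \<times> nat \<times> nat \<Rightarrow> (nat \<Rightarrow> real^'r::finite) \<Rightarrow> (nat \<Rightarrow> real^'r) \<Rightarrow> (nat \<Rightarrow> real^'r) \<Rightarrow>
     (nat \<times> nat \<times> nat \<Rightarrow> real)" where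
  "triple_product s X Y Z = tensor3 s (\<lambda>p q l. \<Sum>i\<in>UNIV. X p $ i * Y q $ i * Z l $ i)"

(* The path u_(-n), ..., u_n with u_0 = c, positive part us = [u_1, ..., u_n] and
   negative part vs = [u_(-1), ..., u_(-n)]. *)
definition two_sided_path :: "nat list \<Rightarrow> nat list \<Rightarrow> nat \<Rightarrow> int \<Rightarrow> nat" where
  "two_sided_path us vs c t =
     (if t > 0 then us ! nat (t - 1) else if t < 0 then vs ! nat (- t - 1) else c)"

definition M_tensor ::
    "'a measure \<Rightarrow> (int \<Rightarrow> 'a \<Rightarrow> nat) \<Rightarrow> nat \<Rightarrow> nat \<Rightarrow> (nat \<times> nat \<times> nat \<Rightarrow> real)" where
  "M_tensor P y d n = tensor3 (d ^ n, d ^ n, d)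
     (\<lambda>p q c. \<P>(\<omega> in P. \<forall>t\<in>{- int n..int n}.
                y t \<omega> = two_sided_path (index_word d n p) (index_word d n q) c t))"

lemma M_tensor_entry:
  assumes "n \<ge> 1" and u: "\<And>t. t \<in> {- int n..int n} \<Longrightarrow> u t \<in> {1..d}"
  shows "M_tensor P y d n
      (word_index d (map (\<lambda>i. u (int i)) [1..<Suc n]),
       word_index d (map (\<lambda>i. u (- int i)) [1..<Suc n]), u 0) =
    \<P>(\<omega> in P. \<forall>t\<in>{- int n..int n}. y t \<omega> = u t)"
proof -
  let ?us = "map (\<lambda>i. u (int i)) [1..<Suc n]" and ?vs = "map (\<lambda>i. u (- int i)) [1..<Suc n]"
  have w: "?us \<in> words d n" "?vs \<in> words d n"
    using u by (fastforce simp: words_def simp del: upt_Suc)+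
  have i: "word_index d ?us \<in> {1..d ^ n}" "word_index d ?vs \<in> {1..d ^ n}"
    using word_index_bij_betw[OF assms(1)] w by (blast dest: bij_betw_apply)+
  have path: "two_sided_path ?us ?vs (u 0) t = u t" if "t \<in> {- int n..int n}" for t
    using that by (auto simp: two_sided_path_def nth_map nth_upt simp del: upt_Suc)
  have "M_tensor P y d n (word_index d ?us, word_index d ?vs, u 0) =
      \<P>(\<omega> in P. \<forall>t\<in>{- int n..int n}. y t \<omega> = two_sided_path ?us ?vs (u 0) t)"
    using i u[of 0]
    by (simp add: M_tensor_def tensor3_def index_word_word_index[OF assms(1) w(1)]
        index_word_word_index[OF assms(1) w(2)] del: upt_Suc One_nat_def)
  also have "\<dots> = \<P>(\<omega> in P. \<forall>t\<in>{- int n..int n}. y t \<omega> = u t)"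
    by (intro arg_cong[where f = "measure P"] Collect_cong) (metis path)
  finally show ?thesis .
qed

end

theory Submission
  imports Defs
begin

text \<open>
  Summing the Markov path probabilities over all hidden paths expresses the law of
  $y_{-n},\dots,y_n$ as $e^T I_{u_n} Q \cdots I_{u_1} Q\, I_{u_0}\, Q I_{u_{-1}} \cdots Q I_{u_{-n}} \rho$.
  Cutting this product at $I_{u_0}$ gives the decomposition of $M$. For the reduced model, $T$
  intertwines all factors ($\hat Q T = T Q$, $\hat I_u T = T I_u$), so that $\hat A T = A$ and
  $\hat B^T = T B^T$, while $\hat O$ is the observation matrix of $\hat\phi$ because $T$ has
  full row rank; hence $\hat A \hat I_u \hat B^T = \hat A \hat I_u T B^T = A I_u B^T$.
\<close>

section \<open>Word products\<close>

lemma word_product_Nil [simp]: "word_product \<phi> Q [] = mat 1"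
  by (simp add: word_product_def)

lemma word_product_snoc:
  "word_product \<phi> Q (us @ [u]) = output_indicator \<phi> u ** Q ** word_product \<phi> Q us"
  by (simp add: word_product_def)

text \<open>The defining fold peels off the last letter. Peeling off the first one serves the later
  inductions: in a word read backwards in time, the first letter is the most recent output.\<close>

lemma word_product_Cons:
  "word_product \<phi> Q (u # us) = word_product \<phi> Q us ** (output_indicator \<phi> u ** Q)"
proof (induction us rule: rev_induct)
  case Nil
  then show ?case by (simp add: word_product_def)
next
  case (snoc v us)
  have "word_product \<phi> Q (u # us @ [v]) = output_indicator \<phi> v ** Q ** word_product \<phi> Q (u # us)"
    using word_product_snoc[of \<phi> Q "u # us" v] by simp
  then show ?case
    by (simp add: snoc.IH word_product_snoc matrix_mul_assoc)
qed

lemma output_indicator_mult_vec: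
  "(output_indicator \<phi> u *v w) $ i = (if \<phi> i = u then w $ i else 0)"
  by (cases "\<phi> i = u")
    (auto simp: matrix_vector_mult_def output_indicator_def if_distrib[where f = "\<lambda>c. c * _"]
      cong: if_cong)

lemma transpose_output_indicator [simp]:
  "transpose (output_indicator \<phi> u) = output_indicator \<phi> u"
  by (auto simp: transpose_def output_indicator_def vec_eq_iff)

text \<open>Transposition reverses the product, so a row of B, read as a column vector, arises by
  applying indicators and \<open>Q\<close> from the left, the first letter of the word acting last.
  This is forward propagation of a state distribution.\<close>

lemma vec_mult_word_product_transpose_Cons:
  "w v* word_product \<phi> (transpose Q) (u # us) =
    Q *v (output_indicator \<phi> u *v (w v* word_product \<phi> (transpose Q) us))"
proof -
  have "v v* output_indicator \<phi> u = output_indicator \<phi> u *v v" for v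
    using vector_transpose_matrix[of v "output_indicator \<phi> u"] by simp
  then show ?thesis
    by (simp add: word_product_Cons vector_matrix_mul_assoc[symmetric])
qed

section \<open>Tensor slices as bilinear forms\<close>

lemma triple_sum_observation_matrix:
  "(\<Sum>i\<in>UNIV. a $ i * b $ i * observation_matrix \<phi> u $ i) = a \<bullet> (output_indicator \<phi> u *v b)"
  by (auto simp: inner_vec_def output_indicator_mult_vec observation_matrix_def intro!: sum.cong)

text \<open>Row \<open>u\<close> of the observation matrix is the diagonal of
  \<open>output_indicator \<phi> u\<close>, so slice \<open>u\<close> of the tensor is A I_u B^T.
  Both equalities of the theorem become statements about these bilinear forms.\<close>

lemma triple_product_observation:
  assumes "\<forall>u\<in>{1..d}. Obs u = observation_matrix \<phi> u"
  shows "triple_product (d ^ n, d ^ n, d) A B Obs =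
    tensor3 (d ^ n, d ^ n, d) (\<lambda>p q u. A p \<bullet> (output_indicator \<phi> u *v B q))"
  unfolding triple_product_def tensor3_def
  by (auto simp: restrict_def fun_eq_iff assms triple_sum_observation_matrix)

section \<open>Output words of a Markov chain\<close>

text \<open>On a window of positive probability the Markov property discards all but the state at
  time \<open>t\<close>, and the transition matrix gives the conditional probability that
  remains.\<close>

lemma markov_step_path:
  fixes X :: "int \<Rightarrow> 'a \<Rightarrow> 'k::finite"
  assumes "stationary_markov_chain P X Q"
  shows "\<P>(\<omega> in P. (\<forall>r\<in>{t - int m..t}. X r \<omega> = s r) \<and> X (t + 1) \<omega> = i) =
    Q $ i $ s t * \<P>(\<omega> in P. \<forall>r\<in>{t - int m..t}. X r \<omega> = s r)"
proof -
  interpret prob_space P using assms by (simp add: stationary_markov_chain_def process_def)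
  have [measurable]: "X t \<in> measurable P (count_space UNIV)" for t
    using assms by (simp add: stationary_markov_chain_def process_def)
  let ?W = "\<lambda>\<omega>. \<forall>r\<in>{t - int m..t}. X r \<omega> = s r"
  have W: "{\<omega> \<in> space P. ?W \<omega>} \<in> events" by measurable
  show ?thesis
  proof (cases "\<P>(\<omega> in P. ?W \<omega>) = 0")
    \<comment> \<open>Conditioning gives no information on a null window; both sides vanish
      instead.\<close>
    case True
    have "\<P>(\<omega> in P. ?W \<omega> \<and> X (t + 1) \<omega> = i) \<le> \<P>(\<omega> in P. ?W \<omega>)"
      using W by (intro finite_measure_mono) auto
    with True show ?thesis by (simp add: measure_le_0_iff)
  next
    case False
    then have pos: "0 < \<P>(\<omega> in P. ?W \<omega>)" by (simp add: zero_less_measure_iff)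
    \<comment> \<open>The window contains \<open>t\<close>, so the state \<open>s t\<close> has
      positive probability; only then is column \<open>s t\<close> of \<open>Q\<close> tied to the
      process.\<close>
    have "\<P>(\<omega> in P. ?W \<omega>) \<le> \<P>(\<omega> in P. X t \<omega> = s t)"
      by (intro finite_measure_mono) auto
    with pos have "\<P>(\<omega> in P. X (t + 1) \<omega> = i \<bar> X t \<omega> = s t) = Q $ i $ s t"
      using assms by (auto simp: stationary_markov_chain_def transition_matrix_def)
    moreover have "\<P>(\<omega> in P. X (t + 1) \<omega> = i \<bar> ?W \<omega>) =
        \<P>(\<omega> in P. X (t + 1) \<omega> = i \<bar> X t \<omega> = s t)"
      using assms pos unfolding stationary_markov_chain_def markov_property_def by blast
    ultimately show ?thesis
      using pos by (simp add: cond_prob_def field_simps conj_commute)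
  qed
qed

text \<open>The observed process need not be Markov. The observed window is therefore split into
  hidden paths, each path takes one step by \<open>markov_step_path\<close>, and the paths are
  regrouped by their state at time \<open>t\<close>.\<close>

lemma markov_step_observed:
  fixes X :: "int \<Rightarrow> 'a \<Rightarrow> 'k::finite"
  assumes "stationary_markov_chain P X Q"
  shows "\<P>(\<omega> in P. (\<forall>r\<in>{t - int m..t}. \<phi> (X r \<omega>) = u r) \<and> X (t + 1) \<omega> = i) =
    (\<Sum>j\<in>UNIV. Q $ i $ j * \<P>(\<omega> in P. (\<forall>r\<in>{t - int m..t}. \<phi> (X r \<omega>) = u r) \<and> X t \<omega> = j))"
proof -
  interpret prob_space P using assms by (simp add: stationary_markov_chain_def process_def)
  have [measurable]: "X t \<in> measurable P (count_space UNIV)" for t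
    using assms by (simp add: stationary_markov_chain_def process_def)
  let ?I = "{t - int m..t}"
  \<comment> \<open>Extensional functions represent each hidden path on the window exactly once,
    which makes the family finite and its events disjoint.\<close>
  define S where "S = {s \<in> ?I \<rightarrow>\<^sub>E (UNIV :: 'k set). \<forall>r\<in>?I. \<phi> (s r) = u r}"
  have fin: "finite S"
    unfolding S_def by (intro finite_subset[OF _ finite_PiE[of ?I "\<lambda>_. UNIV"]]) auto
  \<comment> \<open>Used twice: \<open>R\<close> fixes first the state at time \<open>t + 1\<close>,
    later the state at time \<open>t\<close>.\<close>
  have split: "\<P>(\<omega> in P. (\<forall>r\<in>?I. \<phi> (X r \<omega>) = u r) \<and> R \<omega>) =
      (\<Sum>s\<in>S. \<P>(\<omega> in P. (\<forall>r\<in>?I. X r \<omega> = s r) \<and> R \<omega>))"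
    if [measurable]: "Measurable.pred P R" for R
  proof -
    have "{\<omega> \<in> space P. (\<forall>r\<in>?I. \<phi> (X r \<omega>) = u r) \<and> R \<omega>} =
        (\<Union>s\<in>S. {\<omega> \<in> space P. (\<forall>r\<in>?I. X r \<omega> = s r) \<and> R \<omega>})" (is "?L = ?R")
    proof (intro equalityI subsetI)
      fix \<omega> assume \<omega>: "\<omega> \<in> ?L"
      then have "(\<lambda>r\<in>?I. X r \<omega>) \<in> S" by (auto simp: S_def)
      with \<omega> show "\<omega> \<in> ?R" by (auto intro!: bexI[of _ "\<lambda>r\<in>?I. X r \<omega>"])
    next
      fix \<omega> assume "\<omega> \<in> ?R"
      then show "\<omega> \<in> ?L" by (auto simp: S_def)
    qed
    moreover have "disjoint_family_on (\<lambda>s. {\<omega> \<in> space P. (\<forall>r\<in>?I. X r \<omega> = s r) \<and> R \<omega>}) S"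
    proof (unfold disjoint_family_on_def, intro ballI impI)
      fix s s' assume s: "s \<in> S" "s' \<in> S" "s \<noteq> s'"
      then have "s \<in> ?I \<rightarrow>\<^sub>E UNIV" "s' \<in> ?I \<rightarrow>\<^sub>E UNIV" by (simp_all add: S_def)
      then have "\<exists>r\<in>?I. s r \<noteq> s' r"
        using PiE_ext[of s ?I "\<lambda>_. UNIV" s'] \<open>s \<noteq> s'\<close> by fastforce
      then obtain r where "r \<in> ?I" "s r \<noteq> s' r" ..
      then have "\<not> ((\<forall>r\<in>?I. X r \<omega> = s r) \<and> (\<forall>r\<in>?I. X r \<omega> = s' r))" for \<omega>
        by metis
      then show "{\<omega> \<in> space P. (\<forall>r\<in>?I. X r \<omega> = s r) \<and> R \<omega>} \<inter>
          {\<omega> \<in> space P. (\<forall>r\<in>?I. X r \<omega> = s' r) \<and> R \<omega>} = {}" by blast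
    qed
    ultimately show ?thesis
      using fin by (simp add: finite_measure_finite_Union image_subset_iff)
  qed
  have "\<P>(\<omega> in P. (\<forall>r\<in>?I. \<phi> (X r \<omega>) = u r) \<and> X (t + 1) \<omega> = i) =
      (\<Sum>s\<in>S. Q $ i $ s t * \<P>(\<omega> in P. \<forall>r\<in>?I. X r \<omega> = s r))"
    by (subst split) (simp_all add: markov_step_path[OF assms])
  also have "\<dots> = (\<Sum>s\<in>S. \<Sum>j\<in>UNIV. Q $ i $ j *
      \<P>(\<omega> in P. (\<forall>r\<in>?I. X r \<omega> = s r) \<and> X t \<omega> = j))"
  proof (intro sum.cong refl)
    fix s
    \<comment> \<open>The path already determines the state at time \<open>t\<close>, so only the
      term \<open>j = s t\<close> survives in the inserted sum over \<open>j\<close>.\<close>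
    have last_state: "\<P>(\<omega> in P. (\<forall>r\<in>?I. X r \<omega> = s r) \<and> X t \<omega> = j) =
        (if j = s t then \<P>(\<omega> in P. \<forall>r\<in>?I. X r \<omega> = s r) else 0)" for j
    proof (cases "j = s t")
      case True
      then show ?thesis by (auto intro!: arg_cong[where f = "measure P"])
    next
      case False
      then have "{\<omega> \<in> space P. (\<forall>r\<in>?I. X r \<omega> = s r) \<and> X t \<omega> = j} = {}" by auto
      with False show ?thesis by (simp only: measure_empty if_False)
    qed
    show "Q $ i $ s t * \<P>(\<omega> in P. \<forall>r\<in>?I. X r \<omega> = s r) =
        (\<Sum>j\<in>UNIV. Q $ i $ j * \<P>(\<omega> in P. (\<forall>r\<in>?I. X r \<omega> = s r) \<and> X t \<omega> = j))"
      unfolding last_state by (simp add: if_distrib cong: if_cong)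
  qed
  also have "\<dots> = (\<Sum>j\<in>UNIV. Q $ i $ j * (\<Sum>s\<in>S. \<P>(\<omega> in P. (\<forall>r\<in>?I. X r \<omega> = s r) \<and> X t \<omega> = j)))"
    by (subst sum.swap) (simp add: sum_distrib_left)
  also have "\<dots> = (\<Sum>j\<in>UNIV. Q $ i $ j * \<P>(\<omega> in P. (\<forall>r\<in>?I. \<phi> (X r \<omega>) = u r) \<and> X t \<omega> = j))"
    by (subst split) simp_all
  finally show ?thesis .
qed

text \<open>For a state whose output differs from \<open>u\<close> the joint event is empty; for
  every other state the output condition follows from the state.\<close>

lemma prob_state_and_output:
  "(\<chi> j. \<P>(\<omega> in P. (W \<omega> \<and> \<phi> (X t \<omega>) = u) \<and> X t \<omega> = j)) =
    output_indicator \<phi> u *v (\<chi> j. \<P>(\<omega> in P. W \<omega> \<and> X t \<omega> = j))"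
proof -
  have "\<P>(\<omega> in P. (W \<omega> \<and> \<phi> (X t \<omega>) = u) \<and> X t \<omega> = j) =
      (if \<phi> j = u then \<P>(\<omega> in P. W \<omega> \<and> X t \<omega> = j) else 0)" for j
  proof (cases "\<phi> j = u")
    case True
    then show ?thesis by (auto intro!: arg_cong[where f = "measure P"])
  next
    case False
    then have "{\<omega> \<in> space P. (W \<omega> \<and> \<phi> (X t \<omega>) = u) \<and> X t \<omega> = j} = {}" by auto
    with False show ?thesis by (simp only: measure_empty if_False)
  qed
  then show ?thesis by (simp add: vec_eq_iff output_indicator_mult_vec)
qed

section \<open>Matrix products for past, future and two-sided output words\<close>

text \<open>The half-open window holds exactly \<open>m\<close> outputs and the state is taken one
  step after it, so the empty window leaves just the stationary distribution. The induction splits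
  off the newest output, which is the first letter because the word runs backwards from
  \<open>t\<close>.\<close>

lemma past_output_prob:
  fixes X :: "int \<Rightarrow> 'a \<Rightarrow> 'k::finite"
  assumes chain: "stationary_markov_chain P X Q" and \<rho>: "stationary_distribution P X \<rho>"
  shows "(\<chi> i. \<P>(\<omega> in P. (\<forall>r\<in>{t - int m<..t}. \<phi> (X r \<omega>) = u r) \<and> X (t + 1) \<omega> = i)) =
    \<rho> v* word_product \<phi> (transpose Q) (map (\<lambda>i. u (t - int i)) [0..<m])"
proof (induction m arbitrary: t)
  case 0
  then show ?case using \<rho> by (simp add: stationary_distribution_def vec_eq_iff)
next
  case (Suc m)
  \<comment> \<open>The window of \<open>Suc m\<close> outputs becomes a closed interval, the form a
    Markov step needs; splitting off time \<open>t\<close> then leaves the half-open window of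
    length \<open>m\<close> ending at \<open>t - 1\<close>.\<close>
  have ivl: "{t - int (Suc m)<..t} = {t - int m..t}"
    "{t - int m..t} = insert t {(t - 1) - int m<..t - 1}" by auto
  have "(\<chi> i. \<P>(\<omega> in P. (\<forall>r\<in>{t - int (Suc m)<..t}. \<phi> (X r \<omega>) = u r) \<and> X (t + 1) \<omega> = i)) =
      Q *v (\<chi> j. \<P>(\<omega> in P. (\<forall>r\<in>{t - int m..t}. \<phi> (X r \<omega>) = u r) \<and> X t \<omega> = j))"
    unfolding ivl(1) by (simp add: vec_eq_iff matrix_vector_mult_def markov_step_observed[OF chain])
  also have "(\<chi> j. \<P>(\<omega> in P. (\<forall>r\<in>{t - int m..t}. \<phi> (X r \<omega>) = u r) \<and> X t \<omega> = j)) =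
      (\<chi> j. \<P>(\<omega> in P. ((\<forall>r\<in>{(t - 1) - int m<..t - 1}. \<phi> (X r \<omega>) = u r) \<and> \<phi> (X t \<omega>) = u t)
        \<and> X t \<omega> = j))"
    unfolding ivl(2) by (simp add: conj_ac)
  also have "\<dots> = output_indicator \<phi> (u t) *v
      (\<chi> j. \<P>(\<omega> in P. (\<forall>r\<in>{(t - 1) - int m<..t - 1}. \<phi> (X r \<omega>) = u r) \<and> X t \<omega> = j))"
    by (rule prob_state_and_output[where \<phi> = \<phi> and X = X and t = t])
  also have "(\<chi> j. \<P>(\<omega> in P. (\<forall>r\<in>{(t - 1) - int m<..t - 1}. \<phi> (X r \<omega>) = u r) \<and> X t \<omega> = j)) =
      \<rho> v* word_product \<phi> (transpose Q) (map (\<lambda>i. u (t - 1 - int i)) [0..<m])"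
    using Suc.IH[of "t - 1"] by simp
  also have "Q *v (output_indicator \<phi> (u t) *v
        (\<rho> v* word_product \<phi> (transpose Q) (map (\<lambda>i. u (t - 1 - int i)) [0..<m]))) =
      \<rho> v* word_product \<phi> (transpose Q)
      (u t # map (\<lambda>i. u (t - 1 - int i)) [0..<m])"
    by (simp only: vec_mult_word_product_transpose_Cons)
  also have "u t # map (\<lambda>i. u (t - 1 - int i)) [0..<m] = map (\<lambda>i. u (t - int i)) [0..<Suc m]"
    by (subst map_upt_Suc) (simp add: algebra_simps)
  finally show ?case .
qed

text \<open>Each new output applies one factor I_u Q to the joint vector of observed window and last
  state. The past outputs stay inside the event throughout, since a Markov step accepts a window of
  any length.\<close>

lemma future_output_prob:
  fixes X :: "int \<Rightarrow> 'a \<Rightarrow> 'k::finite"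
  assumes chain: "stationary_markov_chain P X Q"
  shows "(\<chi> i. \<P>(\<omega> in P. (\<forall>r\<in>{t - int m..t + int l}. \<phi> (X r \<omega>) = u r) \<and> X (t + int l) \<omega> = i)) =
    word_product \<phi> Q (map (\<lambda>i. u (t + 1 + int i)) [0..<l]) *v
      (\<chi> i. \<P>(\<omega> in P. (\<forall>r\<in>{t - int m..t}. \<phi> (X r \<omega>) = u r) \<and> X t \<omega> = i))"
proof (induction l)
  case 0
  then show ?case by simp
next
  case (Suc l)
  \<comment> \<open>The window from \<open>t - int m\<close> to \<open>t + int l\<close> is
    described anew from its right end, to match \<open>markov_step_observed\<close>.\<close>
  define t' where "t' = t + int l"
  define m' where "m' = m + l"
  have ivl: "{t - int m..t' + 1} = insert (t' + 1) {t' - int m'..t'}"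
    "{t - int m..t + int l} = {t' - int m'..t'}"
    by (auto simp: t'_def m'_def)
  have t': "t + int (Suc l) = t' + 1" by (simp add: t'_def)
  have future: "(\<forall>r\<in>{t - int m..t' + 1}. R r) \<longleftrightarrow>
      (\<forall>r\<in>{t' - int m'..t'}. R r) \<and> R (t' + 1)" for R
    unfolding ivl(1) by (simp add: conj_commute)
  have "(\<chi> i. \<P>(\<omega> in P. (\<forall>r\<in>{t - int m..t + int (Suc l)}. \<phi> (X r \<omega>) = u r) \<and>
        X (t + int (Suc l)) \<omega> = i)) =
      (\<chi> i. \<P>(\<omega> in P. ((\<forall>r\<in>{t' - int m'..t'}. \<phi> (X r \<omega>) = u r) \<and> \<phi> (X (t' + 1) \<omega>) = u (t' + 1)) \<and>
        X (t' + 1) \<omega> = i))"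
    by (simp only: future t')
  also have "\<dots> = output_indicator \<phi> (u (t' + 1)) *v
      (\<chi> i. \<P>(\<omega> in P. (\<forall>r\<in>{t' - int m'..t'}. \<phi> (X r \<omega>) = u r) \<and> X (t' + 1) \<omega> = i))"
    by (rule prob_state_and_output[where \<phi> = \<phi> and X = X and t = "t' + 1"])
  also have "(\<chi> i. \<P>(\<omega> in P. (\<forall>r\<in>{t' - int m'..t'}. \<phi> (X r \<omega>) = u r) \<and> X (t' + 1) \<omega> = i)) =
      Q *v (\<chi> j. \<P>(\<omega> in P. (\<forall>r\<in>{t' - int m'..t'}. \<phi> (X r \<omega>) = u r) \<and> X t' \<omega> = j))"
    by (simp add: vec_eq_iff matrix_vector_mult_def markov_step_observed[OF chain])
  also have "(\<chi> j. \<P>(\<omega> in P. (\<forall>r\<in>{t' - int m'..t'}. \<phi> (X r \<omega>) = u r) \<and> X t' \<omega> = j)) =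
      word_product \<phi> Q (map (\<lambda>i. u (t + 1 + int i)) [0..<l]) *v
        (\<chi> i. \<P>(\<omega> in P. (\<forall>r\<in>{t - int m..t}. \<phi> (X r \<omega>) = u r) \<and> X t \<omega> = i))"
    using Suc.IH by (simp only: ivl(2)) (simp only: t'_def)
  finally show ?case
    by (simp add: word_product_snoc matrix_vector_mul_assoc matrix_mul_assoc t'_def add_ac)
qed

text \<open>The path is cut at time 0: the past word propagates \<open>\<rho>\<close> to time 0, the
  indicator of \<open>c\<close> records the output there, the future word carries the vector to time
  \<open>n\<close>, and pairing with \<open>ones\<close> sums out the final state.\<close>

lemma two_sided_output_prob:
  fixes X :: "int \<Rightarrow> 'a \<Rightarrow> 'k::finite"
  assumes chain: "stationary_markov_chain P X Q" and \<rho>: "stationary_distribution P X \<rho>"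
    and len: "length us = n" "length vs = n"
  shows "\<P>(\<omega> in P. \<forall>t\<in>{- int n..int n}. \<phi> (X t \<omega>) = two_sided_path us vs c t) =
    (ones v* word_product \<phi> Q us) \<bullet>
      (output_indicator \<phi> c *v (\<rho> v* word_product \<phi> (transpose Q) vs))"
proof -
  interpret prob_space P using chain by (simp add: stationary_markov_chain_def process_def)
  have [measurable]: "X t \<in> measurable P (count_space UNIV)" for t
    using chain by (simp add: stationary_markov_chain_def process_def)
  define u where "u = two_sided_path us vs c"
  let ?I = "{- int n..int n}"
  \<comment> \<open>The word \<open>us\<close> lists times 1 to \<open>n\<close> upwards, and
    \<open>vs\<close> lists times -1 to \<open>- n\<close> downwards.\<close>
  have us: "map (\<lambda>i. u (0 + 1 + int i)) [0..<n] = us"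
    by (rule nth_equalityI) (simp_all add: len u_def two_sided_path_def)
  have vs: "map (\<lambda>i. u (-1 - int i)) [0..<n] = vs"
    by (rule nth_equalityI) (simp_all add: len u_def two_sided_path_def)
  have c: "u 0 = c" by (simp add: u_def two_sided_path_def)
  have ivl: "{0 - int n..0} = insert 0 {-1 - int n<..-1}" by auto
  have "(\<chi> i. \<P>(\<omega> in P. (\<forall>r\<in>{0 - int n..0}. \<phi> (X r \<omega>) = u r) \<and> X 0 \<omega> = i)) =
      (\<chi> i. \<P>(\<omega> in P. ((\<forall>r\<in>{-1 - int n<..-1}. \<phi> (X r \<omega>) = u r) \<and> \<phi> (X 0 \<omega>) = c) \<and> X 0 \<omega> = i))"
    unfolding ivl by (simp add: conj_ac c)
  also have "\<dots> = output_indicator \<phi> c *v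
      (\<chi> i. \<P>(\<omega> in P. (\<forall>r\<in>{-1 - int n<..-1}. \<phi> (X r \<omega>) = u r) \<and> X 0 \<omega> = i))"
    by (rule prob_state_and_output[where \<phi> = \<phi> and X = X and t = 0])
  also have "(\<chi> i. \<P>(\<omega> in P. (\<forall>r\<in>{-1 - int n<..-1}. \<phi> (X r \<omega>) = u r) \<and> X 0 \<omega> = i)) =
      \<rho> v* word_product \<phi> (transpose Q) vs"
    using past_output_prob[OF chain \<rho>, of "-1" n \<phi> u] by (simp add: vs)
  finally have past: "(\<chi> i. \<P>(\<omega> in P. (\<forall>r\<in>{0 - int n..0}. \<phi> (X r \<omega>) = u r) \<and> X 0 \<omega> = i)) =
      output_indicator \<phi> c *v (\<rho> v* word_product \<phi> (transpose Q) vs)" .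
  have "{\<omega> \<in> space P. \<forall>t\<in>?I. \<phi> (X t \<omega>) = u t} =
      (\<Union>i. {\<omega> \<in> space P. (\<forall>t\<in>?I. \<phi> (X t \<omega>) = u t) \<and> X (int n) \<omega> = i})" by auto
  then have "\<P>(\<omega> in P. \<forall>t\<in>?I. \<phi> (X t \<omega>) = u t) =
      (\<Sum>i\<in>UNIV. \<P>(\<omega> in P. (\<forall>t\<in>?I. \<phi> (X t \<omega>) = u t) \<and> X (int n) \<omega> = i))"
    by (simp only:) (intro finite_measure_finite_Union, auto simp: disjoint_family_on_def)
  also have "\<dots> = ones \<bullet> (\<chi> i. \<P>(\<omega> in P. (\<forall>t\<in>?I. \<phi> (X t \<omega>) = u t) \<and> X (int n) \<omega> = i))"
    by (simp add: inner_vec_def)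
  also have "\<dots> = ones \<bullet> (word_product \<phi> Q us *v
      (output_indicator \<phi> c *v (\<rho> v* word_product \<phi> (transpose Q) vs)))"
    using future_output_prob[OF chain, of 0 n n \<phi> u] unfolding past us by simp
  finally show ?thesis by (simp add: u_def dot_lmul_matrix)
qed

text \<open>Fixing finitely many coordinates is an event of the product sigma-algebra, so its
  probability can be read off from the law.\<close>

lemma prob_eq_of_process_law_eq:
  assumes "process P X" "process P' X'" "process_law P X = process_law P' X'" "finite I"
  shows "\<P>(\<omega> in P. \<forall>t\<in>I. X t \<omega> = s t) = \<P>(\<omega> in P'. \<forall>t\<in>I. X' t \<omega> = s t)"
proof -
  let ?E = "{f \<in> space (Pi\<^sub>M UNIV (\<lambda>_::int. count_space UNIV)). \<forall>t\<in>I. f t = s t}"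
  have E: "?E \<in> sets (Pi\<^sub>M UNIV (\<lambda>_. count_space UNIV))"
    using assms(4) by measurable
  have law: "measure (process_law R Z) ?E = \<P>(\<omega> in R. \<forall>t\<in>I. Z t \<omega> = s t)" if "process R Z" for R Z
  proof -
    have "(\<lambda>\<omega> t. Z t \<omega>) \<in> measurable R (Pi\<^sub>M UNIV (\<lambda>_. count_space UNIV))"
      using that by (intro measurable_PiM_single') (auto simp: process_def)
    then show ?thesis
      unfolding process_law_def using E
      by (subst measure_distr) (auto intro!: arg_cong[where f = "measure R"] simp: space_PiM)
  qed
  show ?thesis
    using law[OF assms(1)] law[OF assms(2)] assms(3) by simp
qed

section \<open>Intertwined realizations\<close>

text \<open>\<open>T\<close> mixes only states with equal output labels, so label \<open>u\<close>
  may be selected before or after applying \<open>T\<close>.\<close>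

lemma output_indicator_intertwine:
  assumes "\<And>i j. \<phi>h i \<noteq> \<phi> j \<Longrightarrow> T $ i $ j = 0"
  shows "output_indicator \<phi>h u ** T = T ** output_indicator \<phi> u"
proof -
  have "(output_indicator \<phi>h u *v (T *v v)) $ i = (T *v (output_indicator \<phi> u *v v)) $ i" for v i
  proof -
    have "(T *v (output_indicator \<phi> u *v v)) $ i =
        (\<Sum>j\<in>UNIV. T $ i $ j * (if \<phi> j = u then v $ j else 0))"
      by (simp add: matrix_vector_mult_def[of T] output_indicator_mult_vec)
    also have "\<dots> = (\<Sum>j\<in>UNIV. if \<phi>h i = u then T $ i $ j * v $ j else 0)"
      using assms by (intro sum.cong) auto
    also have "\<dots> = (output_indicator \<phi>h u *v (T *v v)) $ i"
      by (simp add: output_indicator_mult_vec matrix_vector_mult_def[of T])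
    finally show ?thesis by simp
  qed
  then show ?thesis
    by (simp add: matrix_eq vec_eq_iff matrix_vector_mul_assoc[symmetric])
qed

lemma word_product_intertwine:
  assumes "\<And>u. output_indicator \<phi>h u ** T = T ** output_indicator \<phi> u" and "Qh ** T = T ** Q"
  shows "word_product \<phi>h Qh us ** T = T ** word_product \<phi> Q us"
proof (induction us)
  case Nil
  then show ?case by simp
next
  case (Cons u us)
  have "word_product \<phi>h Qh us ** (output_indicator \<phi>h u ** Qh) ** T =
      word_product \<phi>h Qh us ** (output_indicator \<phi>h u ** (Qh ** T))"
    by (simp only: matrix_mul_assoc)
  also have "\<dots> = word_product \<phi>h Qh us ** ((output_indicator \<phi>h u ** T) ** Q)"
    by (simp only: assms matrix_mul_assoc)
  also have "\<dots> = (word_product \<phi>h Qh us ** T) ** (output_indicator \<phi> u ** Q)"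
    by (simp only: assms matrix_mul_assoc)
  finally show ?case by (simp add: word_product_Cons Cons.IH matrix_mul_assoc)
qed

text \<open>As a column vector the row involves \<open>Qh\<close> itself rather than its transpose,
  so the relation \<open>Qh ** T = T ** Q\<close> again carries \<open>T\<close> out to the
  left.\<close>

lemma vec_mult_word_product_transpose_intertwine:
  assumes ind: "\<And>u. output_indicator \<phi>h u ** T = T ** output_indicator \<phi> u"
    and Q: "Qh ** T = T ** Q"
  shows "(T *v \<rho>) v* word_product \<phi>h (transpose Qh) us =
    T *v (\<rho> v* word_product \<phi> (transpose Q) us)"
proof (induction us)
  case Nil
  then show ?case by simp
next
  case (Cons u us)
  have ind': "output_indicator \<phi>h u *v (T *v w) = T *v (output_indicator \<phi> u *v w)" for u w
    using ind[of u] by (simp add: matrix_vector_mul_assoc)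
  have Q': "Qh *v (T *v w) = T *v (Q *v w)" for w
    using Q by (simp add: matrix_vector_mul_assoc)
  show ?case
    by (simp only: vec_mult_word_product_transpose_Cons Cons.IH ind' Q')
qed

text \<open>Column \<open>j\<close> of \<open>T\<close> is supported on the rows labelled
  \<open>\<phi> j\<close> and sums to 1, so its sum over the rows labelled \<open>u\<close> is 1 if
  \<open>\<phi> j = u\<close> and 0 otherwise.\<close>

lemma vec_mult_observation_matrix:
  fixes T :: "real^'k::finite^'m::finite"
  assumes T: "\<And>i j. \<phi>h i \<noteq> \<phi> j \<Longrightarrow> T $ i $ j = 0" and ones: "(ones :: real^'k) = ones v* T"
  shows "observation_matrix \<phi>h u v* T = observation_matrix \<phi> u"
proof -
  have "(observation_matrix \<phi>h u v* T) $ j = observation_matrix \<phi> u $ j" for j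
  proof -
    have "(observation_matrix \<phi>h u v* T) $ j = (\<Sum>i\<in>UNIV. if \<phi> j = u then T $ i $ j else 0)"
      unfolding vector_matrix_mult_def observation_matrix_def
      using T by (auto intro!: sum.cong)
    also have "\<dots> = (if \<phi> j = u then (ones v* T) $ j else 0)"
      by (simp add: vector_matrix_mult_def)
    finally show ?thesis by (simp add: ones[symmetric] observation_matrix_def)
  qed
  then show ?thesis by (simp add: vec_eq_iff)
qed

text \<open>Multiplying a row by \<open>T\<close> amounts to applying the transpose of
  \<open>T\<close>, which is injective when \<open>T\<close> has full row rank.\<close>

lemma full_row_rank_cancel:
  fixes T :: "real^'k::finite^'m::finite"
  assumes "rank T = CARD('m)" and "a v* T = b v* T"
  shows "a = b"
proof -
  have "inj ((*v) (transpose T))"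
    using assms(1) full_rank_injective[of "transpose T"] by (simp add: rank_transpose)
  with assms(2) show ?thesis by (auto simp: inj_def)
qed

theorem theorem7:
  fixes P :: "'a measure" and y :: "int \<Rightarrow> 'a \<Rightarrow> nat"
    and P' :: "'b measure" and x :: "int \<Rightarrow> 'b \<Rightarrow> 'k::finite"
    and \<phi> :: "'k \<Rightarrow> nat" and Obs :: "nat \<Rightarrow> real^'k" and Q :: "real^'k^'k" and \<rho> :: "real^'k"
    and T :: "real^'k^'m::finite" and \<phi>h :: "'m \<Rightarrow> nat"
    and Qh :: "real^'m^'m" and Obsh :: "nat \<Rightarrow> real^'m" and \<rho>h :: "real^'m"
    and d n :: nat
  assumes "n \<ge> 1"
    and "hmm_realization d P y P' x \<phi> Obs Q"
    and "stationary_distribution P' x \<rho>"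
    and "CARD('m) = CARD('k) - dim (null_space d \<phi> Q)"
    and "CARD('m) < CARD('k)"
    and "rank T = CARD('m)"
    and "\<forall>i. \<phi>h i \<in> {1..d}"
    and "\<forall>i j. \<phi>h i \<noteq> \<phi> j \<longrightarrow> T $ i $ j = 0"
    and "null_space d \<phi> Q = {v. T *v v = 0}"
    and "(ones :: real^'k) = (ones :: real^'m) v* T"
    and "Qh ** T = T ** Q"
    and "\<forall>u\<in>{1..d}. Obsh u v* T = Obs u"
    and "\<rho>h = T *v \<rho>"
  shows "M_tensor P y d n =
           triple_product (d ^ n, d ^ n, d) (A_matrix \<phi> Q d n) (B_matrix \<phi> Q \<rho> d n) Obs
       \<and> triple_product (d ^ n, d ^ n, d) (A_matrix \<phi> Q d n) (B_matrix \<phi> Q \<rho> d n) Obs =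
           triple_product (d ^ n, d ^ n, d) (A_matrix \<phi>h Qh d n) (B_matrix \<phi>h Qh \<rho>h d n) Obsh"
proof
  have d1: "\<forall>u\<in>{1..d}. Obs u = observation_matrix \<phi> u"
    and chain: "stationary_markov_chain P' x Q"
    and law: "process_law P y = process_law P' (\<lambda>t \<omega>. \<phi> (x t \<omega>))"
    and proc: "process P y" "process P' (\<lambda>t \<omega>. \<phi> (x t \<omega>))"
    using assms(2)
    by (auto simp: hmm_realization_def stationary_markov_chain_def process_def
        intro: measurable_compose[where g = \<phi>])
  have word: "index_word d n p \<in> words d n" if "p \<in> {1..d ^ n}" for p
    using that word_index_bij_betw[OF assms(1), of d]
    by (auto simp: index_word_def bij_betw_def intro!: inv_into_into)
  \<comment> \<open>Equality of laws moves the probability from \<open>y\<close> to the output of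
    the hidden chain, where the two-sided product formula applies; \<open>word\<close> supplies the
    lengths of the two words.\<close>
  have "\<P>(\<omega> in P. \<forall>t\<in>{- int n..int n}.
        y t \<omega> = two_sided_path (index_word d n p) (index_word d n q) c t) =
      A_matrix \<phi> Q d n p \<bullet> (output_indicator \<phi> c *v B_matrix \<phi> Q \<rho> d n q)"
    if "p \<in> {1..d ^ n}" "q \<in> {1..d ^ n}" for p q c
    unfolding A_matrix_def B_matrix_def word_rows_def
    using word that
    by (subst prob_eq_of_process_law_eq[OF proc law])
      (auto simp: words_def intro!: two_sided_output_prob[OF chain assms(3)])
  then show "M_tensor P y d n =
      triple_product (d ^ n, d ^ n, d) (A_matrix \<phi> Q d n) (B_matrix \<phi> Q \<rho> d n) Obs"
    unfolding triple_product_observation[OF d1] M_tensor_def tensor3_def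
    by (auto simp: restrict_def fun_eq_iff)

  have T: "\<And>i j. \<phi>h i \<noteq> \<phi> j \<Longrightarrow> T $ i $ j = 0" using assms(8) by blast
  note ind = output_indicator_intertwine[of \<phi>h \<phi> T, OF T]
  \<comment> \<open>\<open>Obsh\<close> is known only through its product with \<open>T\<close>; the
    observation matrix of \<open>\<phi>h\<close> has the same product, and \<open>T\<close>
    cancels.\<close>
  have d2: "\<forall>u\<in>{1..d}. Obsh u = observation_matrix \<phi>h u"
  proof (intro ballI full_row_rank_cancel[OF assms(6)])
    fix u assume "u \<in> {1..d}"
    then show "Obsh u v* T = observation_matrix \<phi>h u v* T"
      using assms(12) d1 vec_mult_observation_matrix[of \<phi>h \<phi> T, OF T assms(10)] by simp
  qed
  have A: "A_matrix \<phi>h Qh d n p v* T = A_matrix \<phi> Q d n p" for p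
    by (simp add: A_matrix_def word_rows_def vector_matrix_mul_assoc assms(10)
        word_product_intertwine[OF ind assms(11)])
  have B: "B_matrix \<phi>h Qh \<rho>h d n q = T *v B_matrix \<phi> Q \<rho> d n q" for q
    by (simp add: B_matrix_def word_rows_def assms(13)
        vec_mult_word_product_transpose_intertwine[OF ind assms(11)])
  \<comment> \<open>\<open>T\<close> emerges from the reduced B row, passes the indicator, and is
    absorbed by the reduced A row.\<close>
  have "A_matrix \<phi>h Qh d n p \<bullet> (output_indicator \<phi>h c *v B_matrix \<phi>h Qh \<rho>h d n q) =
      A_matrix \<phi> Q d n p \<bullet> (output_indicator \<phi> c *v B_matrix \<phi> Q \<rho> d n q)" for p q c
  proof -
    have "output_indicator \<phi>h c *v B_matrix \<phi>h Qh \<rho>h d n q =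
        T *v (output_indicator \<phi> c *v B_matrix \<phi> Q \<rho> d n q)"
      by (simp add: B matrix_vector_mul_assoc ind)
    then show ?thesis by (simp add: dot_lmul_matrix[symmetric] A)
  qed
  then show "triple_product (d ^ n, d ^ n, d) (A_matrix \<phi> Q d n) (B_matrix \<phi> Q \<rho> d n) Obs =
      triple_product (d ^ n, d ^ n, d) (A_matrix \<phi>h Qh d n) (B_matrix \<phi>h Qh \<rho>h d n) Obsh"
    by (simp only: triple_product_observation[OF d1] triple_product_observation[OF d2])
qed

end
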